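(* Let $V$ be a finite set of variants partitioned into semantic classes $\mathcal{C}$, and let $m:V\to[0,1]$ be a score function. Suppose there exist a semantic class $c\in\mathcal{C}$ and two variants $v_1,v_2\in c$ such that $m(v_1)>m(v_2)$. Then the audit metric $\mathsf{M}_m$ on the strategy set $\mathcal{X}=\Delta(V)$ is not manipulation invariant.
   Context: Variants and classes. $V$ is a finite set of content variants. A published audit protocol consists of a finite relation $T_0\subseteq V\times V$, a function $A:V\times V\to\{0,1\}$, a confidence score $s(v,u)\in[0,1]$ for each pair in $T_0$, and a threshold $\rho\in[0,1]$; its edge set is $E_\rho=\{(v,u)\in T_0: A(v,u)=1 \text{ and } s(v,u)\ge\rho\}$. The set $\mathcal{C}$ of semantic classes is the set of equivalence classes of the reflexive-symmetric-transitive closure of $E_\rho$, so $\mathcal{C}$ is a partition of $V$. Write $\mathrm{cl}(v)\in\mathcal{C}$ for the class containing $v$. Strategies. The set of platform strategies is the probability simplex $\mathcal{X}=\Delta(V)=\{x\in\mathbb{R}_{\ge 0}^{V}:\sum_{v\in V}x_v=1\}$. Metric. For $m:V\to[0,1]$ and $x\in\mathcal{X}$, $\mathsf{M}_m(x)=\sum_{v\in V}x_v m(v)$. Manipulation invariance. $\mathsf{M}_m$ is manipulation invariant if for all $x,x'\in\mathcal{X}$ such that $\sum_{v:\mathrm{cl}(v)=c}x_v=\sum_{v:\mathrm{cl}(v)=c}x'_v$ for every $c\in\mathcal{C}$, one has $\mathsf{M}_m(x)=\mathsf{M}_m(x')$. *)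

theory Defs
  imports Complex_Main "HOL-Library.FuncSet" "HOL-Library.Disjoint_Sets"
begin

text \<open>
  The variants form a carrier set \<open>V\<close> inside a type. The agreement function and the score are total
  HOL functions; only their values on \<open>V \<times> V\<close> and on \<open>cand P\<close> (the relation $T_0$) matter.
  The truth values of \<open>agree\<close> stand for 1 and 0.
\<close>

record 'v protocol =
  cand :: "('v \<times> 'v) set"
  agree :: "'v \<times> 'v \<Rightarrow> bool"
  conf :: "'v \<times> 'v \<Rightarrow> real"
  threshold :: real

definition audit_protocol :: "'v set \<Rightarrow> 'v protocol \<Rightarrow> bool" where
  "audit_protocol V P \<longleftrightarrow>
     finite (cand P) \<and> cand P \<subseteq> V \<times> V \<and> conf P \<in> cand P \<rightarrow> {0..1} \<and> threshold P \<in> {0..1}"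

definition edges :: "'v protocol \<Rightarrow> ('v \<times> 'v) set" where
  "edges P = {e \<in> cand P. agree P e \<and> conf P e \<ge> threshold P}"

text \<open>\<open>equivclp\<close> is reflexive on the whole type, hence the restriction to \<open>V\<close>.\<close>

definition sem_equiv :: "'v set \<Rightarrow> 'v protocol \<Rightarrow> ('v \<times> 'v) set" where
  "sem_equiv V P = {(v, u) \<in> V \<times> V. equivclp (\<lambda>a b. (a, b) \<in> edges P) v u}"

definition classes :: "'v set \<Rightarrow> 'v protocol \<Rightarrow> 'v set set" where
  "classes V P = V // sem_equiv V P"

definition cl :: "'v set \<Rightarrow> 'v protocol \<Rightarrow> 'v \<Rightarrow> 'v set" where
  "cl V P v = sem_equiv V P `` {v}"

text \<open>Strategies are extensional (\<open>undefined\<close> outside \<open>V\<close>), so that they correspond one-to-one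
  to vectors indexed by \<open>V\<close>.\<close>

definition strategies :: "'v set \<Rightarrow> ('v \<Rightarrow> real) set" where
  "strategies V = {x \<in> V \<rightarrow>\<^sub>E {0..}. (\<Sum>v\<in>V. x v) = 1}"

definition metric :: "'v set \<Rightarrow> ('v \<Rightarrow> real) \<Rightarrow> ('v \<Rightarrow> real) \<Rightarrow> real" where
  "metric V m x = (\<Sum>v\<in>V. x v * m v)"

definition manipulation_invariant ::
    "'v set \<Rightarrow> 'v protocol \<Rightarrow> (('v \<Rightarrow> real) \<Rightarrow> real) \<Rightarrow> bool" where
  "manipulation_invariant V P M \<longleftrightarrow>
     (\<forall>x\<in>strategies V. \<forall>x'\<in>strategies V.
        (\<forall>c\<in>classes V P. (\<Sum>v | v \<in> V \<and> cl V P v = c. x v) = (\<Sum>v | v \<in> V \<and> cl V P v = c. x' v))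
        \<longrightarrow> M x = M x')"

lemma equiv_sem_equiv: "equiv V (sem_equiv V P)"
proof (rule equivI)
  show "sem_equiv V P \<subseteq> V \<times> V"
    by (auto simp: sem_equiv_def)
  show "refl_on V (sem_equiv V P)"
    by (auto simp: refl_on_def sem_equiv_def)
  show "sym (sem_equiv V P)"
    by (auto simp: sym_def sem_equiv_def intro: equivclp_sym)
  show "trans (sem_equiv V P)"
    by (auto simp: trans_def sem_equiv_def intro: equivclp_trans)
qed

lemma partition_on_classes: "partition_on V (classes V P)"
  unfolding classes_def by (rule partition_on_quotient[OF equiv_sem_equiv])

lemma cl_eq_iff:
  assumes "v \<in> V"
  shows "cl V P v = c \<longleftrightarrow> c \<in> classes V P \<and> v \<in> c"
proof
  assume "cl V P v = c"
  then show "c \<in> classes V P \<and> v \<in> c"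
    using assms equiv_class_self[OF equiv_sem_equiv assms]
    by (auto simp: cl_def classes_def intro: quotientI)
next
  assume c: "c \<in> classes V P \<and> v \<in> c"
  then obtain u where "u \<in> V" "c = sem_equiv V P `` {u}"
    by (auto simp: classes_def elim: quotientE)
  then show "cl V P v = c"
    using c equiv_class_eq[OF equiv_sem_equiv, of u v V P] by (auto simp: cl_def)
qed

end

theory Submission
  imports Defs
begin

text \<open>Moving all mass from \<open>v1\<close> to \<open>v2\<close> stays inside the class
  \<open>c\<close>, so no class weight changes, yet the metric drops from \<open>m v1\<close> to
  \<open>m v2\<close>. The two point masses thus refute invariance;
  \<open>class_weight_point_mass\<close> and \<open>metric_point_mass\<close> compute both sides.
  \<open>point_mass\<close> is restricted to \<open>V\<close> because strategies are
  extensional.\<close>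

definition point_mass :: "'v set \<Rightarrow> 'v \<Rightarrow> 'v \<Rightarrow> real" where
  "point_mass V w = (\<lambda>v\<in>V. of_bool (v = w))"

text \<open>Only the term at \<open>w\<close> survives. Taking \<open>f\<close> as \<open>m\<close>
  gives the metric; taking \<open>f\<close> constantly 1 gives the total mass and the class
  weights.\<close>

lemma sum_point_mass:
  assumes "finite V" "A \<subseteq> V"
  shows "(\<Sum>v\<in>A. point_mass V w v * f v) = (if w \<in> A then f w else 0)"
proof -
  have "(\<Sum>v\<in>A. point_mass V w v * f v) = (\<Sum>v\<in>A. if v = w then f v else 0)"
    \<comment> \<open>Outside \<open>V\<close> the point mass is \<open>undefined\<close>, so
      \<open>A \<subseteq> V\<close> is what makes the summands agree.\<close>
    using assms(2) by (intro sum.cong) (auto simp: point_mass_def)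
  then show ?thesis
    using finite_subset[OF assms(2,1)] by simp
qed

lemma point_mass_in_strategies:
  assumes "finite V" "w \<in> V"
  shows "point_mass V w \<in> strategies V"
  using sum_point_mass[OF assms(1) subset_refl, of w "\<lambda>_. 1"] assms(2)
  by (auto simp: strategies_def point_mass_def)

lemma metric_point_mass:
  assumes "finite V" "w \<in> V"
  shows "metric V m (point_mass V w) = m w"
  using assms by (simp add: metric_def sum_point_mass)

lemma class_weight_point_mass:
  assumes "finite V" "w \<in> V"
  shows "(\<Sum>v | v \<in> V \<and> cl V P v = d. point_mass V w v) = of_bool (cl V P w = d)"
  using sum_point_mass[OF assms(1), of "{v \<in> V. cl V P v = d}" w "\<lambda>_. 1"] assms(2)
  by simp

theorem proposition1:
  fixes V :: "'v set" and P :: "'v protocol" and m :: "'v \<Rightarrow> real"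
    and c :: "'v set" and v1 v2 :: 'v
  assumes "finite V"
    and "audit_protocol V P"
    and "m \<in> V \<rightarrow> {0..1}"
    and "c \<in> classes V P"
    and "v1 \<in> c" and "v2 \<in> c"
    and "m v1 > m v2"
  shows "\<not> manipulation_invariant V P (metric V m)"
proof
  assume inv: "manipulation_invariant V P (metric V m)"
  have V: "v1 \<in> V" "v2 \<in> V"
    using partition_onD1[OF partition_on_classes, of V P] assms(4-6) by auto
  then have "cl V P v1 = c" "cl V P v2 = c"
    using assms(4-6) by (simp_all add: cl_eq_iff)
  \<comment> \<open>Both point masses give weight 1 to \<open>c\<close> and 0 to every other class,
    so invariance applies to them.\<close>
  then have "metric V m (point_mass V v1) = metric V m (point_mass V v2)"
    using inv V assms(1)
    by (simp add: manipulation_invariant_def point_mass_in_strategies class_weight_point_mass)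
  then show False
    using V assms(1,7) by (simp add: metric_point_mass)
qed

end
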